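(* For $n,k\ge 0$ let $a^{321}_{n,k}$ be the number of permutations $\sigma\in S_n$ that avoid the classical pattern $3\textrm{-}1\textrm{-}2$ and contain exactly $k$ occurrences of the consecutive pattern $321$, and let $A^{321}(t,z)=\sum_{n,k\ge 0}a^{321}_{n,k}t^nz^k$. Then $$A^{321}(t,z)=\frac{1-t+tz-\sqrt{1-2t-3t^2+tz(tz+2t-2)}}{2t(t+z-tz)},$$ and $$a^{321}_{n,k}=\frac{1}{n+1}\sum_{j=0}^{k}(-1)^{k-j}\binom{n+j}{n}\binom{n+1}{k-j}\sum_{i=j}^{\lfloor (n+j)/2\rfloor}\binom{n+j+1-k}{i+1}\binom{n-i}{i-j}.$$
   Context: A permutation $\sigma\in S_n$ avoids the classical pattern $3\textrm{-}1\textrm{-}2$ if there are no indices $i<j<l$ with $\sigma(j)<\sigma(l)<\sigma(i)$. For $\tau\in S_3$, an occurrence of the consecutive pattern $\tau$ in $\sigma\in S_n$ is an index $i$, $1\le i\le n-2$, such that $\sigma(i)\sigma(i+1)\sigma(i+2)$ is order-isomorphic to $\tau$; for $\tau=321$ this means $\sigma(i)>\sigma(i+1)>\sigma(i+2)$. *)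

theory Defs
  imports
    "HOL-Combinatorics.Permutations"
    "HOL-Computational_Algebra.Computational_Algebra"
begin

definition avoids_312 :: "nat \<Rightarrow> (nat \<Rightarrow> nat) \<Rightarrow> bool" where
  "avoids_312 n \<sigma> \<longleftrightarrow>
     \<not> (\<exists>i j l. 1 \<le> i \<and> i < j \<and> j < l \<and> l \<le> n \<and> \<sigma> j < \<sigma> l \<and> \<sigma> l < \<sigma> i)"

definition occ_321 :: "nat \<Rightarrow> (nat \<Rightarrow> nat) \<Rightarrow> nat set" where
  "occ_321 n \<sigma> = {i. 1 \<le> i \<and> i + 2 \<le> n \<and> \<sigma> i > \<sigma> (i + 1) \<and> \<sigma> (i + 1) > \<sigma> (i + 2)}"

definition a321 :: "nat \<Rightarrow> nat \<Rightarrow> nat" where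
  "a321 n k = card {\<sigma>. \<sigma> permutes {1..n} \<and> avoids_312 n \<sigma> \<and> card (occ_321 n \<sigma>) = k}"

text \<open>
  The ring of formal power series in \<open>t\<close> and \<open>z\<close> is modelled as power series in \<open>t\<close> whose
  coefficients are power series in \<open>z\<close>.
\<close>

abbreviation var_t :: "rat fps fps" where
  "var_t \<equiv> fps_X"

abbreviation var_z :: "rat fps fps" where
  "var_z \<equiv> fps_const fps_X"

definition A321 :: "rat fps fps" where
  "A321 = Abs_fps (\<lambda>n. Abs_fps (\<lambda>k. of_nat (a321 n k)))"

text \<open>
  The branch of the square root with constant term 1. The library's \<open>fps_radical\<close> requires
  coefficients in a field, which \<open>rat fps\<close> is not. Over an integral domain of characteristic
  other than 2 such a root is unique if it exists.
\<close>

definition fps_sqrt :: "'a::idom fps \<Rightarrow> 'a fps" where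
  "fps_sqrt F = (THE S. S ^ 2 = F \<and> fps_nth S 0 = 1)"

end

theory Submission
  imports Defs
begin

unbundle fps_syntax

text \<open>
  If a 312-avoiding permutation ends in \<open>v\<close>, all values below \<open>v\<close> precede all values above \<open>v\<close>, so
  it has the form \<open>L R v\<close> with \<open>L < v < R\<close>. This identifies 312-avoiding permutations with binary
  trees, and a consecutive 321 occurs at the end exactly if \<open>R\<close> ends with a descent. A nonempty
  permutation does not end with a descent iff its last entry is the maximum, in which case removing
  that entry preserves all occurrences. Hence
  \<open>A = 1 + t A W\<close> with \<open>W = A + (z - 1) (A - 1 - t A)\<close>, that is,
  \<open>A = 1 + t (1 - z) A + t (t + z - t z) A\<^sup>2\<close>, and completing the square gives the closed form.

  For \<open>y = t A\<close> the same equation reads \<open>y = t \<phi>(y)\<close> with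
  \<open>\<phi>(x) = (1 + (1 - z) (x + x\<^sup>2)) / (1 - z x)\<close>, so Lagrange inversion gives
  \<open>(n + 1) [t\<^sup>n] A = [x\<^sup>n] \<phi>(x)\<^bsup>n+1\<^esup>\<close>, which is expanded by the binomial theorem.
\<close>

section \<open>Words and binary trees\<close>

fun list_avoids_312 :: "nat list \<Rightarrow> bool" where
  "list_avoids_312 [] \<longleftrightarrow> True"
| "list_avoids_312 (x # xs) \<longleftrightarrow>
     sorted_wrt (\<lambda>b c. \<not> (b < c \<and> c < x)) xs \<and> list_avoids_312 xs"

fun list_occ_321 :: "nat list \<Rightarrow> nat" where
  "list_occ_321 (a # b # c # xs) =
     (if a > b \<and> b > c then 1 else 0) + list_occ_321 (b # c # xs)"
| "list_occ_321 _ = 0"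

fun ends_with_descent :: "nat list \<Rightarrow> bool" where
  "ends_with_descent [a, b] \<longleftrightarrow> a > b"
| "ends_with_descent (a # b # c # xs) \<longleftrightarrow> ends_with_descent (b # c # xs)"
| "ends_with_descent _ \<longleftrightarrow> False"

datatype btree = Leaf | Node btree btree

text \<open>Postorder reading of the tree whose nodes are labelled \<open>m\<close>,
  \<open>m + 1\<close>, ... in inorder. The offset lets a right subtree use the values above its
  root.\<close>

primrec tree_word :: "nat \<Rightarrow> btree \<Rightarrow> nat list" where
  "tree_word m Leaf = []"
| "tree_word m (Node l r) = tree_word m l @ tree_word (m + size l + 1) r @ [m + size l]"

text \<open>In \<open>tree_word\<close>, a nonempty \<open>r\<close> puts a larger value directly
  before the final root, while an empty \<open>r\<close> leaves the root as the maximum. This is the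
  tree form of a final descent.\<close>

primrec right_heavy :: "btree \<Rightarrow> bool" where
  "right_heavy Leaf \<longleftrightarrow> False"
| "right_heavy (Node l r) \<longleftrightarrow> r \<noteq> Leaf"

primrec tree_occ :: "btree \<Rightarrow> nat" where
  "tree_occ Leaf = 0"
| "tree_occ (Node l r) = tree_occ l + tree_occ r + of_bool (right_heavy r)"

text \<open>A 312 that straddles the cut has either its last two entries in \<open>ys\<close> or its
  first two in \<open>xs\<close>.\<close>

lemma list_avoids_312_append:
  "list_avoids_312 (xs @ ys) \<longleftrightarrow> list_avoids_312 xs \<and> list_avoids_312 ys \<and>
     (\<forall>a\<in>set xs. sorted_wrt (\<lambda>b c. \<not> (b < c \<and> c < a)) ys) \<and>
     (\<forall>c\<in>set ys. sorted_wrt (\<lambda>a b. \<not> (b < c \<and> c < a)) xs)"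
  by (induction xs) (auto simp: sorted_wrt_append)

lemma length_tree_word [simp]: "length (tree_word m t) = size t"
  by (induction t arbitrary: m) auto

lemma set_tree_word: "set (tree_word m t) = {m..<m + size t}"
proof (induction t arbitrary: m)
  case (Node l r)
  show ?case by (auto simp: Node)
qed auto

lemma distinct_tree_word: "distinct (tree_word m t)"
  by (induction t arbitrary: m) (auto simp: set_tree_word)

lemma sorted_wrtI_set: "(\<And>x y. x \<in> set xs \<Longrightarrow> y \<in> set xs \<Longrightarrow> P x y) \<Longrightarrow> sorted_wrt P xs"
  by (induction xs) auto

lemma list_avoids_312_tree_word: "list_avoids_312 (tree_word m t)"
proof (induction t arbitrary: m)
  case (Node l r)
  show ?case
    by (auto simp: Node list_avoids_312_append sorted_wrt_append set_tree_word
        intro!: sorted_wrtI_set)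
qed auto

text \<open>The last entry is \<open>m + size l\<close>, so it reveals the size of the left subtree
  and thus where the word has to be cut.\<close>

lemma inj_tree_word: "tree_word m s = tree_word m t \<Longrightarrow> s = t"
proof (induction s arbitrary: m t)
  case Leaf
  then show ?case by (cases t) auto
next
  case (Node l r)
  then obtain l' r' where t: "t = Node l' r'"
    by (cases t) auto
  from Node.prems have "size l = size l'" by (simp add: t flip: append_assoc)
  with Node.prems show ?case
    by (auto simp: t dest: Node.IH)
qed

text \<open>An entry above \<open>v\<close> followed by one below \<open>v\<close> would form a 312
  with the final \<open>v\<close>.\<close>

lemma list_avoids_312_snoc_split:
  assumes "list_avoids_312 (xs @ [v])" and "v \<notin> set xs"
  obtains ls rs where "xs = ls @ rs" "\<forall>x\<in>set ls. x < v" "\<forall>x\<in>set rs. v < x"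
proof -
  define ls rs where "ls = takeWhile (\<lambda>x. x < v) xs" and "rs = dropWhile (\<lambda>x. x < v) xs"
  have xs: "xs = ls @ rs" by (simp add: ls_def rs_def)
  have "\<forall>x\<in>set rs. v < x"
  proof (cases rs)
    case (Cons r rs')
    have "\<not> r < v"
      using Cons by (simp add: rs_def dropWhile_eq_Cons_conv)
    then have "v < r" using assms(2) xs Cons by (auto simp: nat_neq_iff)
    moreover have "\<forall>b\<in>set rs'. \<not> (b < v \<and> v < r)"
      using assms(1) by (auto simp: xs Cons list_avoids_312_append sorted_wrt_append)
    moreover have "v \<notin> set rs'" using assms(2) xs Cons by auto
    ultimately show ?thesis by (metis Cons linorder_neqE_nat set_ConsD)
  qed auto
  moreover have "\<forall>x\<in>set ls. x < v" by (auto simp: ls_def dest: set_takeWhileD)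
  ultimately show ?thesis using xs that by blast
qed

text \<open>The last entry becomes the root. The two blocks of the split fill the intervals of
  values below and above it, so strong induction yields both subtrees.\<close>

lemma surj_tree_word:
  assumes "distinct xs" "set xs = {m..<m + n}" "list_avoids_312 xs"
  shows "\<exists>t. size t = n \<and> tree_word m t = xs"
  using assms
proof (induction n arbitrary: m xs rule: less_induct)
  case (less n)
  show ?case
  proof (cases xs rule: rev_cases)
    case Nil
    then have "n = 0" using less.prems(2) by simp
    with Nil show ?thesis by (intro exI[of _ Leaf]) auto
  next
    case (snoc ys v)
    then obtain ls rs where ys: "ys = ls @ rs" and lt: "\<forall>x\<in>set ls. x < v" and gt: "\<forall>x\<in>set rs. v < x"
      using list_avoids_312_snoc_split[of ys v] less.prems by auto
    have un: "set ls \<union> set rs \<union> {v} = {m..<m + n}"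
      using less.prems(2) by (auto simp: snoc ys)
    have v: "m \<le> v" "v < m + n" using un by auto
    have sls: "set ls = {m..<m + (v - m)}"
    proof (intro equalityI subsetI)
      fix x assume "x \<in> set ls"
      then show "x \<in> {m..<m + (v - m)}" using lt un by force
    next
      fix x assume x: "x \<in> {m..<m + (v - m)}"
      then have "x \<in> set ls \<union> set rs \<union> {v}" unfolding un using v by auto
      then show "x \<in> set ls" using x gt v by force
    qed
    have srs: "set rs = {Suc v..<Suc v + (m + n - Suc v)}"
    proof (intro equalityI subsetI)
      fix x assume "x \<in> set rs"
      then show "x \<in> {Suc v..<Suc v + (m + n - Suc v)}" using gt un v by force
    next
      fix x assume x: "x \<in> {Suc v..<Suc v + (m + n - Suc v)}"
      then have "x \<in> set ls \<union> set rs \<union> {v}" unfolding un using v by auto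
      then show "x \<in> set rs" using x lt v by force
    qed
    have "distinct ls" "distinct rs" "list_avoids_312 ls" "list_avoids_312 rs"
      using less.prems(1,3) by (auto simp: snoc ys list_avoids_312_append)
    then obtain l r where l: "size l = v - m" "tree_word m l = ls"
      and r: "size r = m + n - Suc v" "tree_word (Suc v) r = rs"
      using less.IH[OF _ _ sls] less.IH[OF _ _ srs] v by force
    then show ?thesis
      using v by (intro exI[of _ "Node l r"]) (auto simp: snoc ys)
  qed
qed

section \<open>Occurrences of 321 in words of trees\<close>

text \<open>The step from \<open>xs\<close> to \<open>ys\<close> is an ascent, so no occurrence
  straddles the cut.\<close>

lemma list_occ_321_append:
  assumes "\<forall>x\<in>set xs. \<forall>y\<in>set ys. x < y"
  shows "list_occ_321 (xs @ ys) = list_occ_321 xs + list_occ_321 ys"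
  using assms
proof (induction xs rule: list_occ_321.induct)
  case ("2_2" a)
  then show ?case by (cases ys rule: list_occ_321.cases) auto
next
  case ("2_3" a b)
  then show ?case by (cases ys rule: list_occ_321.cases) auto
qed auto

text \<open>The step down to \<open>v\<close> is always a descent; it completes an occurrence
  exactly when another descent precedes it.\<close>

lemma list_occ_321_snoc:
  assumes "\<forall>x\<in>set xs. v < x"
  shows "list_occ_321 (xs @ [v]) = list_occ_321 xs + of_bool (ends_with_descent xs)"
  using assms by (induction xs rule: ends_with_descent.induct) auto

lemma ends_with_descent_snoc:
  "ends_with_descent (xs @ [v]) \<longleftrightarrow> xs \<noteq> [] \<and> v < last xs"
  by (induction xs rule: ends_with_descent.induct) auto

lemma ends_with_descent_tree_word:
  "ends_with_descent (tree_word m t) \<longleftrightarrow> right_heavy t"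
proof (cases t)
  case (Node l r)
  have ne: "tree_word k s = [] \<longleftrightarrow> s = Leaf" for k s
    by (cases s) auto
  have mem: "tree_word k s \<noteq> [] \<Longrightarrow> last (tree_word k s) \<in> {k..<k + size s}" for k s
    by (metis last_in_set set_tree_word)
  show ?thesis
    using mem[of m l] mem[of "m + size l + 1" r] ends_with_descent_snoc
    by (cases r) (auto simp: Node ne ends_with_descent_snoc simp flip: append_assoc)
qed auto

lemma list_occ_321_tree_word: "list_occ_321 (tree_word m t) = tree_occ t"
proof (induction t arbitrary: m)
  case (Node l r)
  have "list_occ_321 (tree_word m (Node l r)) =
      list_occ_321 (tree_word m l) + list_occ_321 (tree_word (m + size l + 1) r @ [m + size l])"
    by (simp, rule list_occ_321_append) (auto simp: set_tree_word)
  also have "list_occ_321 (tree_word (m + size l + 1) r @ [m + size l]) =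
      list_occ_321 (tree_word (m + size l + 1) r) +
      of_bool (ends_with_descent (tree_word (m + size l + 1) r))"
    by (rule list_occ_321_snoc) (auto simp: set_tree_word)
  finally show ?case
    by (simp add: Node ends_with_descent_tree_word)
qed auto

section \<open>From permutations to words and trees\<close>

lemma sorted_wrt_upt: "sorted_wrt P [a..<b] \<longleftrightarrow> (\<forall>i j. a \<le> i \<and> i < j \<and> j < b \<longrightarrow> P i j)"
  by (induction b) (force simp: sorted_wrt_append less_Suc_eq)+

lemma list_avoids_312_map_upt:
  "list_avoids_312 (map f [a..<b]) \<longleftrightarrow>
     \<not> (\<exists>i j l. a \<le> i \<and> i < j \<and> j < l \<and> l < b \<and> f j < f l \<and> f l < f i)"
proof (induction "b - a" arbitrary: a)
  case (Suc d)
  then have "a < b" and IH: "list_avoids_312 (map f [Suc a..<b]) \<longleftrightarrow>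
     \<not> (\<exists>i j l. Suc a \<le> i \<and> i < j \<and> j < l \<and> l < b \<and> f j < f l \<and> f l < f i)"
    by auto
  then have "list_avoids_312 (map f [a..<b]) \<longleftrightarrow>
      \<not> (\<exists>j l. a < j \<and> j < l \<and> l < b \<and> f j < f l \<and> f l < f a) \<and>
      \<not> (\<exists>i j l. Suc a \<le> i \<and> i < j \<and> j < l \<and> l < b \<and> f j < f l \<and> f l < f i)"
    by (auto simp: upt_conv_Cons sorted_wrt_map sorted_wrt_upt Suc_le_eq)
  moreover have "a \<le> i \<longleftrightarrow> i = a \<or> Suc a \<le> i" for i by auto
  ultimately show ?case
    by (simp only: ex_disj_distrib conj_disj_distribR simp_thms ex_simps de_Morgan_disj)
qed auto

lemma list_occ_321_map_upt:
  "list_occ_321 (map f [a..<b]) =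
     card {i. a \<le> i \<and> i + 2 < b \<and> f i > f (i + 1) \<and> f (i + 1) > f (i + 2)}"
proof (induction "b - a" arbitrary: a)
  case 0
  then have empty: "{i. a \<le> i \<and> i + 2 < b \<and> f i > f (i + 1) \<and> f (i + 1) > f (i + 2)} = {}" by auto
  show ?case using 0 unfolding empty by simp
next
  case (Suc d)
  let ?S = "\<lambda>a. {i. a \<le> i \<and> i + 2 < b \<and> f i > f (i + 1) \<and> f (i + 1) > f (i + 2)}"
  have IH: "list_occ_321 (map f [Suc a..<b]) = card (?S (Suc a))"
    using Suc by simp
  have fin: "finite (?S (Suc a))" by (rule finite_subset[of _ "{..<b}"]) auto
  show ?case
  proof (cases "a + 2 < b")
    case True
    then have up: "[a..<b] = a # (a + 1) # (a + 2) # [a + 3..<b]"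
      "[Suc a..<b] = (a + 1) # (a + 2) # [a + 3..<b]"
      by (simp_all add: upt_conv_Cons numeral_eq_Suc)
    let ?P = "f a > f (a + 1) \<and> f (a + 1) > f (a + 2)"
    have "?S a = (if ?P then insert a (?S (Suc a)) else ?S (Suc a))"
      using True by (auto simp: Suc_le_eq le_less)
    then have "card (?S a) = (if ?P then 1 else 0) + card (?S (Suc a))"
      using fin by (auto simp: card_insert_if)
    with IH show ?thesis by (simp add: up)
  next
    case False
    then have "?S a = {}" by auto
    moreover from False Suc(2) have "b = a + 1 \<or> b = a + 2" by auto
    then have "list_occ_321 (map f [a..<b]) = 0"
      by (auto simp: upt_conv_Cons numeral_eq_Suc)
    ultimately show ?thesis by (simp only: card.empty)
  qed
qed

lemma bij_betw_permutes_distinct_lists: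
  "bij_betw (\<lambda>\<sigma>. map \<sigma> [1..<n + 1]) {\<sigma>. \<sigma> permutes {1..n}} {xs. distinct xs \<and> set xs = {1..n}}"
proof (rule bij_betw_imageI)
  show "inj_on (\<lambda>\<sigma>. map \<sigma> [1..<n + 1]) {\<sigma>. \<sigma> permutes {1..n}}"
  proof (rule inj_onI, rule ext)
    fix \<sigma> \<tau> x
    assume *: "\<sigma> \<in> {\<sigma>. \<sigma> permutes {1..n}}" "\<tau> \<in> {\<sigma>. \<sigma> permutes {1..n}}"
      "map \<sigma> [1..<n + 1] = map \<tau> [1..<n + 1]"
    show "\<sigma> x = \<tau> x"
    proof (cases "x \<in> {1..n}")
      case True
      then show ?thesis using *(3) by (auto simp del: upt_Suc)
    next
      case False
      then show ?thesis using *(1,2) by (auto simp: permutes_def)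
    qed
  qed
  have "xs \<in> (\<lambda>\<sigma>. map \<sigma> [1..<n + 1]) ` {\<sigma>. \<sigma> permutes {1..n}}"
    if xs: "distinct xs" "set xs = {1..n}" for xs
  proof -
    \<comment> \<open>List positions start at 0, hence \<open>i - 1\<close>; off
      \<open>{1..n}\<close> the notion \<open>permutes\<close> forces the identity.\<close>
    define \<sigma> where "\<sigma> i = (if i \<in> {1..n} then xs ! (i - 1) else i)" for i
    have len: "length xs = n" using xs by (metis card_atLeastAtMost diff_Suc_1 distinct_card)
    have map: "map \<sigma> [1..<n + 1] = xs"
      by (rule nth_equalityI) (auto simp: len \<sigma>_def simp del: upt_Suc)
    then have "\<sigma> ` {1..n} = {1..n}"
      by (metis xs(2) list.set_map set_upt atLeastLessThanSuc_atLeastAtMost Suc_eq_plus1)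
    then have "bij_betw \<sigma> {1..n} {1..n}"
      by (simp add: bij_betw_def eq_card_imp_inj_on)
    then have "\<sigma> permutes {1..n}"
      by (rule bij_imp_permutes) (auto simp: \<sigma>_def)
    with map show ?thesis by blast
  qed
  then show "(\<lambda>\<sigma>. map \<sigma> [1..<n + 1]) ` {\<sigma>. \<sigma> permutes {1..n}} = {xs. distinct xs \<and> set xs = {1..n}}"
    by (auto simp: distinct_map permutes_inj_on permutes_image
        atLeastLessThanSuc_atLeastAtMost simp del: upt_Suc)
qed

text \<open>One-line notation carries permutations to words on \<open>{1..n}\<close>, and
  \<open>tree_word 1\<close> carries trees bijectively to the 312-avoiding ones. Both preserve the
  number of occurrences.\<close>

lemma a321_eq_card_trees: "a321 n k = card {t. size t = n \<and> tree_occ t = k}"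
proof -
  let ?w = "\<lambda>\<sigma>. map \<sigma> [1..<n + 1]"
  have av: "avoids_312 n \<sigma> \<longleftrightarrow> list_avoids_312 (?w \<sigma>)" for \<sigma>
    unfolding avoids_312_def list_avoids_312_map_upt by (simp add: less_Suc_eq_le)
  have occ: "card (occ_321 n \<sigma>) = list_occ_321 (?w \<sigma>)" for \<sigma>
    unfolding occ_321_def list_occ_321_map_upt by (simp add: less_Suc_eq_le)
  have "a321 n k = card {\<sigma> \<in> {\<sigma>. \<sigma> permutes {1..n}}. list_avoids_312 (?w \<sigma>) \<and> list_occ_321 (?w \<sigma>) = k}"
    unfolding a321_def av occ by simp
  also have "\<dots> = card {xs. distinct xs \<and> set xs = {1..n} \<and> list_avoids_312 xs \<and> list_occ_321 xs = k}"
  proof (rule bij_betw_same_card[of ?w])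
    show "bij_betw ?w {\<sigma> \<in> {\<sigma>. \<sigma> permutes {1..n}}. list_avoids_312 (?w \<sigma>) \<and> list_occ_321 (?w \<sigma>) = k}
        {xs. distinct xs \<and> set xs = {1..n} \<and> list_avoids_312 xs \<and> list_occ_321 xs = k}"
      using bij_betw_Collect[OF bij_betw_permutes_distinct_lists[of n],
          of "\<lambda>xs. list_avoids_312 xs \<and> list_occ_321 xs = k", OF refl]
      by (simp only: mem_Collect_eq conj_assoc)
  qed
  also have "\<dots> = card {t. size t = n \<and> tree_occ t = k}"
  proof (rule sym, rule bij_betw_same_card[of "tree_word 1"], rule bij_betw_imageI)
    show "inj_on (tree_word 1) {t. size t = n \<and> tree_occ t = k}"
      by (auto intro: inj_onI inj_tree_word)
    show "tree_word 1 ` {t. size t = n \<and> tree_occ t = k} =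
        {xs. distinct xs \<and> set xs = {1..n} \<and> list_avoids_312 xs \<and> list_occ_321 xs = k}"
    proof (intro equalityI subsetI)
      fix xs assume "xs \<in> {xs. distinct xs \<and> set xs = {1..n} \<and> list_avoids_312 xs \<and> list_occ_321 xs = k}"
      then have *: "distinct xs" "set xs = {1..<1 + n}" "list_avoids_312 xs" "list_occ_321 xs = k"
        by (auto simp: atLeastLessThanSuc_atLeastAtMost)
      from surj_tree_word[OF *(1-3)] *(4) show "xs \<in> tree_word 1 ` {t. size t = n \<and> tree_occ t = k}"
        by (auto simp: list_occ_321_tree_word)
    qed (auto simp: list_occ_321_tree_word list_avoids_312_tree_word distinct_tree_word
        set_tree_word)
  qed
  finally show ?thesis .
qed

section \<open>Lagrange inversion over an integral domain\<close>

lemma fps_X_mult_deriv_nth: "(fps_X * fps_deriv f) $ n = of_nat n * (f :: 'a::comm_semiring_1 fps) $ n"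
  by (cases n) auto

text \<open>
  The proof is by induction on \<open>n\<close>: \<open>y\<^sup>r = t\<^sup>r (\<phi>\<^sup>r)(y)\<close> expresses the coefficient of index \<open>n\<close> of \<open>y\<^sup>r\<close>
  through those of index \<open>n - r\<close> of powers of \<open>y\<close>. No division is needed, so the ring of coefficients
  need not be a field.
\<close>

lemma lagrange_inversion_power:
  fixes \<phi> y :: "'a::{idom,semiring_char_0} fps"
  assumes y: "y = fps_X * (\<phi> oo y)" and "r \<le> n"
  shows "of_nat n * (y ^ r) $ n = of_nat r * (\<phi> ^ n) $ (n - r)"
  using \<open>r \<le> n\<close>
proof (induction n arbitrary: r rule: less_induct)
  case (less n)
  have y0: "y $ 0 = 0" by (subst y) simp
  show ?case
  proof (cases "r = 0")
    case True
    then show ?thesis by (cases n) auto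
  next
    case False
    define d where "d = n - r"
    have n: "n = d + r" using less.prems by (simp add: d_def)
    have "y ^ r = fps_X ^ r * (\<phi> ^ r oo y)"
      by (subst y) (simp add: power_mult_distrib fps_compose_power[OF y0])
    then have yr: "(y ^ r) $ n = (\<phi> ^ r oo y) $ d"
      by (simp add: fps_X_power_mult_nth n)
    show ?thesis
    proof (cases "d = 0")
      case True
      then show ?thesis using yr n by simp
    next
      case False
      \<comment> \<open>The extra factor \<open>d\<close> makes the induction hypothesis applicable
        to \<open>(y ^ m) $ d\<close>, as \<open>d < n\<close>. It is cancelled at the end, being
        nonzero in characteristic 0.\<close>
      have "of_nat d * (of_nat n * (y ^ r) $ n) =
          of_nat n * (\<Sum>m = 0..d. (\<phi> ^ r) $ m * (of_nat d * (y ^ m) $ d))"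
        by (simp add: yr fps_compose_nth sum_distrib_left mult_ac)
      also have "(\<Sum>m = 0..d. (\<phi> ^ r) $ m * (of_nat d * (y ^ m) $ d)) =
          (\<Sum>m = 0..d. (\<phi> ^ r) $ m * (of_nat m * (\<phi> ^ d) $ (d - m)))"
        using \<open>r \<noteq> 0\<close> n by (intro sum.cong refl) (simp add: less.IH)
      \<comment> \<open>The factor \<open>m\<close> comes from the operator
        \<open>fps_X * fps_deriv\<close>, which turns the sum into a convolution.\<close>
      also have "\<dots> = ((fps_X * fps_deriv (\<phi> ^ r)) * \<phi> ^ d) $ d"
        unfolding fps_mult_nth[of "fps_X * fps_deriv (\<phi> ^ r)"] fps_X_mult_deriv_nth
        by (simp add: mult_ac)
      also have "of_nat n * \<dots> = (of_nat n * ((fps_X * fps_deriv (\<phi> ^ r)) * \<phi> ^ d)) $ d"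
        by (simp flip: fps_of_nat)
      \<comment> \<open>Since \<open>d + r = n\<close>, both sides are n r x
        \<open>\<phi>\<close>^(n-1) times the derivative of \<open>\<phi>\<close>.\<close>
      also have "of_nat n * ((fps_X * fps_deriv (\<phi> ^ r)) * \<phi> ^ d) =
          of_nat r * (fps_X * fps_deriv (\<phi> ^ n))"
      proof -
        have "\<phi> ^ (r - 1) * \<phi> ^ d = \<phi> ^ (n - 1)"
          using \<open>r \<noteq> 0\<close> by (simp add: n add.commute flip: power_add)
        then show ?thesis
          unfolding fps_deriv_power' by (metis (no_types, lifting) mult.assoc mult.left_commute)
      qed
      also have "\<dots> $ d = of_nat r * (of_nat d * (\<phi> ^ n) $ d)"
        by (simp add: fps_X_mult_deriv_nth flip: fps_of_nat)
      finally have "of_nat d * (of_nat n * (y ^ r) $ n) = of_nat d * (of_nat r * (\<phi> ^ n) $ d)"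
        by (simp add: mult_ac)
      with False show ?thesis by (simp add: d_def)
    qed
  qed
qed

lemma lagrange_inversion:
  fixes \<phi> y :: "'a::{idom,semiring_char_0} fps"
  assumes y: "y = fps_X * (\<phi> oo y)"
  shows "of_nat (n + 1) * y $ (n + 1) = (\<phi> ^ (n + 1)) $ n"
  using lagrange_inversion_power[OF y, of 1 "n + 1"] by simp

section \<open>Coefficients\<close>

lemma geometric_fps_mult: "Abs_fps (\<lambda>n. c ^ n) * (1 - fps_const c * fps_X) = (1 :: 'a::comm_ring_1 fps)"
proof (rule fps_ext)
  show "(Abs_fps (\<lambda>n. c ^ n) * (1 - fps_const c * fps_X)) $ n = (1 :: 'a fps) $ n" for n
    by (cases n) (simp_all add: right_diff_distrib mult.left_commute[of _ "fps_const c"])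
qed

text \<open>The expansion of 1/(1 - c x)^(n+1). One more geometric factor sums the binomials
  obtained so far, and the hockey-stick identity evaluates the sum.\<close>

lemma geometric_fps_power_nth:
  "(Abs_fps (\<lambda>n. c ^ n) ^ (n + 1)) $ j = of_nat ((n + j) choose n) * (c :: 'a::comm_ring_1) ^ j"
proof (induction n arbitrary: j)
  case 0
  then show ?case by simp
next
  case (Suc n)
  have "(Abs_fps (\<lambda>n. c ^ n) ^ (Suc n + 1)) $ j = (Abs_fps (\<lambda>n. c ^ n) ^ (n + 1) * Abs_fps (\<lambda>n. c ^ n)) $ j"
    by (simp add: mult_ac)
  also have "\<dots> = (\<Sum>i = 0..j. of_nat ((n + i) choose n) * c ^ i * c ^ (j - i))"
    by (simp only: fps_mult_nth Suc fps_nth_Abs_fps)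
  also have "\<dots> = (\<Sum>i\<le>j. of_nat ((n + i) choose i) * c ^ j)"
  proof (intro sum.cong)
    fix i assume "i \<in> {..j}"
    then have "c ^ i * c ^ (j - i) = c ^ j" by (simp flip: power_add)
    moreover have "(n + i) choose n = (n + i) choose i" using binomial_symmetric[of i "n + i"] by simp
    ultimately show "of_nat ((n + i) choose n) * c ^ i * c ^ (j - i) = of_nat ((n + i) choose i) * c ^ j"
      by (simp add: mult.assoc)
  qed auto
  also have "\<dots> = of_nat (\<Sum>i\<le>j. (n + i) choose i) * c ^ j"
    by (simp add: sum_distrib_right)
  also have "(\<Sum>i\<le>j. (n + i) choose i) = (Suc n + j) choose Suc n"
    using binomial_symmetric[of j "Suc n + j"] by (simp add: sum_choose_lower)
  finally show ?case .
qed

lemma fps_one_plus_X_power_nth: "((1 + fps_X) ^ m) $ e = (of_nat (m choose e) :: 'a::comm_ring_1)"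
proof -
  have "((1 + fps_X) ^ m :: 'a fps) = (\<Sum>k\<le>m. of_nat (m choose k) * fps_X ^ k)"
    by (subst add.commute, subst binomial_ring) simp
  also have "\<dots> $ e = (\<Sum>k\<le>m. if k = e then of_nat (m choose k) else 0)"
    by (simp add: fps_sum_nth fps_X_power_nth if_distrib cong: if_cong flip: fps_of_nat)
  also have "\<dots> = of_nat (m choose e)" by (simp add: binomial_eq_0)
  finally show ?thesis .
qed

text \<open>Factor the quadratic term as c x (1 + x) and apply the binomial theorem twice, first to
  the outer power and then to (1 + x)^m.\<close>

lemma fps_quadratic_power_nth:
  fixes c :: "'a::comm_ring_1"
  shows "((1 + fps_const c * (fps_X + fps_X ^ 2)) ^ N) $ e =
    (\<Sum>m\<le>e. of_nat (N choose m) * c ^ m * of_nat (m choose (e - m)))"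
proof -
  have "1 + fps_const c * (fps_X + fps_X ^ 2) = fps_const c * fps_X * (1 + fps_X) + 1"
    by (simp add: algebra_simps power2_eq_square)
  then have "(1 + fps_const c * (fps_X + fps_X ^ 2)) ^ N =
      (\<Sum>m\<le>N. of_nat (N choose m) * (fps_const c * fps_X * (1 + fps_X)) ^ m)"
    by (simp only: binomial_ring power_one mult_1_right)
  also have "\<dots> = (\<Sum>m\<le>N. fps_const (of_nat (N choose m) * c ^ m) * (fps_X ^ m * (1 + fps_X) ^ m))"
    by (intro sum.cong refl) (simp add: power_mult_distrib fps_of_nat mult_ac flip: fps_const_mult)
  also have "\<dots> $ e = (\<Sum>m\<le>N. if m \<le> e then of_nat (N choose m) * c ^ m * of_nat (m choose (e - m)) else 0)"
    by (simp add: fps_sum_nth fps_X_power_mult_nth fps_one_plus_X_power_nth if_distrib cong: if_cong)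
      (intro sum.cong refl, auto)
  also have "\<dots> = (\<Sum>m \<in> {..N} \<inter> {..e}. of_nat (N choose m) * c ^ m * of_nat (m choose (e - m)))"
    by (subst sum.inter_restrict) simp_all
  also have "\<dots> = (\<Sum>m\<le>e. of_nat (N choose m) * c ^ m * of_nat (m choose (e - m)))"
    by (intro sum.mono_neutral_left ballI) (auto simp: binomial_eq_0 not_le)
  finally show ?thesis .
qed

text \<open>Here the series variable plays the role of z; this serves to extract the coefficient of
  z^k at the end.\<close>

lemma fps_X_power_one_minus_X_power_nth:
  "((fps_X ^ j * (1 - fps_X) ^ m) :: 'a::comm_ring_1 fps) $ k =
     (if j \<le> k then (-1) ^ (k - j) * of_nat (m choose (k - j)) else 0)"
proof -
  have "((1 - fps_X) ^ m :: 'a fps) = (\<Sum>i\<le>m. of_nat (m choose i) * (- fps_X) ^ i)"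
    using binomial_ring[of "- fps_X :: 'a fps" 1 m] by simp
  also have "\<dots> = (\<Sum>i\<le>m. fps_const (of_nat (m choose i) * (-1) ^ i) * fps_X ^ i)"
    by (intro sum.cong refl, subst power_minus)
      (simp add: fps_of_nat flip: fps_const_mult fps_const_power fps_const_neg)
  finally have eq: "((1 - fps_X) ^ m :: 'a fps) =
      (\<Sum>i\<le>m. fps_const (of_nat (m choose i) * (-1) ^ i) * fps_X ^ i)" .
  have "((1 - fps_X) ^ m :: 'a fps) $ e = (-1) ^ e * of_nat (m choose e)" for e
  proof -
    have "((1 - fps_X) ^ m :: 'a fps) $ e = (\<Sum>i\<le>m. if i = e then of_nat (m choose i) * (-1) ^ i else 0)"
      unfolding eq fps_sum_nth fps_mult_left_const_nth fps_X_power_nth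
      by (intro sum.cong refl) auto
    also have "\<dots> = (-1) ^ e * of_nat (m choose e)"
      by (simp add: binomial_eq_0 mult.commute)
    finally show ?thesis .
  qed
  then show ?thesis by (auto simp: fps_X_power_mult_nth)
qed

section \<open>The functional equation\<close>

text \<open>The marker \<open>z\<close> is an arbitrary ring element, so the series stays univariate
  for Lagrange inversion; \<open>z = fps_X\<close> recovers the bivariate series.\<close>

definition tree_gf :: "'a::comm_ring_1 \<Rightarrow> 'a fps" where
  "tree_gf z = Abs_fps (\<lambda>n. \<Sum>t | size t = n. z ^ tree_occ t)"

lemma trees_Suc:
  "{t. size t = Suc n} = (\<lambda>(l, r). Node l r) ` (\<Union>i\<le>n. {l. size l = i} \<times> {r. size r = n - i})"
proof (intro equalityI subsetI)
  fix t :: btree assume "t \<in> {t. size t = Suc n}"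
  then obtain l r where "t = Node l r" "size l + size r = n" by (cases t) auto
  then show "t \<in> (\<lambda>(l, r). Node l r) ` (\<Union>i\<le>n. {l. size l = i} \<times> {r. size r = n - i})"
    by (auto simp: image_iff)
qed auto

lemma trees_0: "{t :: btree. size t = 0} = {Leaf}"
proof (intro equalityI subsetI)
  fix t :: btree assume "t \<in> {t. size t = 0}"
  then show "t \<in> {Leaf}" by (cases t) auto
qed auto

lemma finite_trees: "finite {t :: btree. size t = n}"
proof (induction n rule: less_induct)
  case (less n)
  show ?case
  proof (cases n)
    case 0
    then show ?thesis by (simp add: trees_0)
  next
    case (Suc m)
    then show ?thesis
      by (simp only: trees_Suc) (intro finite_imageI finite_UN_I finite_cartesian_product finite_atMost less; simp)
  qed
qed

lemma sum_trees_Suc: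
  "(\<Sum>t | size t = Suc n. f t) = (\<Sum>i\<le>n. \<Sum>l | size l = i. \<Sum>r | size r = n - i. f (Node l r))"
proof -
  have "(\<Sum>t | size t = Suc n. f t) =
      (\<Sum>(l, r) \<in> (\<Union>i\<le>n. {l. size l = i} \<times> {r. size r = n - i}). f (Node l r))"
    unfolding trees_Suc by (subst sum.reindex) (auto simp: inj_on_def case_prod_unfold)
  also have "\<dots> = (\<Sum>i\<le>n. \<Sum>(l, r) \<in> {l. size l = i} \<times> {r. size r = n - i}. f (Node l r))"
    by (subst sum.UNION_disjoint) (auto simp: finite_trees)
  finally show ?thesis by (simp add: sum.cartesian_product)
qed

lemma sum_not_right_heavy:
  "(\<Sum>t | size t = Suc n \<and> \<not> right_heavy t. f (tree_occ t)) = (\<Sum>t | size t = n. f (tree_occ t))"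
proof -
  have "{t. size t = Suc n \<and> \<not> right_heavy t} = (\<lambda>l. Node l Leaf) ` {l. size l = n}"
  proof (intro equalityI subsetI)
    fix t assume "t \<in> {t. size t = Suc n \<and> \<not> right_heavy t}"
    then show "t \<in> (\<lambda>l. Node l Leaf) ` {l. size l = n}"
      by (cases t) auto
  qed auto
  then show ?thesis by (simp add: sum.reindex inj_on_def)
qed

text \<open>The weight \<open>z ^ of_bool b\<close> is z plus (1 - z) if \<open>b\<close> fails. The
  trees that are not right-heavy are \<open>Leaf\<close> and the \<open>Node l Leaf\<close>, which
  together contribute \<open>1 + fps_X * tree_gf z\<close>.\<close>

lemma right_heavy_gf:
  fixes z :: "'a::comm_ring_1"
  shows "Abs_fps (\<lambda>n. \<Sum>t | size t = n. z ^ (tree_occ t + of_bool (right_heavy t))) =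
    fps_const z * tree_gf z + fps_const (1 - z) * (1 + fps_X * tree_gf z)" (is "?W = ?R")
proof (rule fps_ext)
  fix n show "?W $ n = ?R $ n"
  proof (cases n)
    case 0
    then show ?thesis by (simp add: tree_gf_def trees_0)
  next
    case (Suc m)
    have "(\<Sum>t | size t = Suc m. z ^ (tree_occ t + of_bool (right_heavy t))) =
        (\<Sum>t | size t = Suc m. z * z ^ tree_occ t + (1 - z) * (if \<not> right_heavy t then z ^ tree_occ t else 0))"
      by (intro sum.cong refl) (auto simp: algebra_simps)
    also have "\<dots> = z * (\<Sum>t | size t = Suc m. z ^ tree_occ t) +
        (1 - z) * (\<Sum>t | size t = Suc m \<and> \<not> right_heavy t. z ^ tree_occ t)"
      using sum.inter_filter[OF finite_trees[of "Suc m"], of "\<lambda>t. z ^ tree_occ t" "\<lambda>t. \<not> right_heavy t"]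
      by (simp only: sum.distrib sum_distrib_left[symmetric] mem_Collect_eq)
    finally show ?thesis
      by (simp add: Suc sum_not_right_heavy tree_gf_def)
  qed
qed

lemma tree_gf_quadratic:
  fixes z :: "'a::comm_ring_1"
  defines "A \<equiv> tree_gf z" and "Z \<equiv> fps_const z"
  shows "A = 1 + fps_X * (1 - Z) * A + fps_X * (fps_X + Z - fps_X * Z) * A ^ 2"
proof -
  \<comment> \<open>The series of right subtrees, whose weight includes the possible occurrence
    ending at the root above them.\<close>
  let ?W = "Abs_fps (\<lambda>n. \<Sum>t | size t = n. z ^ (tree_occ t + of_bool (right_heavy t)))"
  have "A = 1 + fps_X * (A * ?W)"
  proof (rule fps_ext)
    fix n show "A $ n = (1 + fps_X * (A * ?W)) $ n"
    proof (cases n)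
      case 0
      then show ?thesis by (simp add: A_def tree_gf_def trees_0)
    next
      case (Suc m)
      have "A $ Suc m = (\<Sum>i\<le>m. (\<Sum>l | size l = i. z ^ tree_occ l) *
          (\<Sum>r | size r = m - i. z ^ (tree_occ r + of_bool (right_heavy r))))"
        unfolding A_def tree_gf_def fps_nth_Abs_fps sum_trees_Suc
        by (simp only: sum_product tree_occ.simps(2) power_add mult.assoc)
      also have "\<dots> = (A * ?W) $ m"
        by (simp only: fps_mult_nth A_def tree_gf_def fps_nth_Abs_fps atLeast0AtMost)
      finally show ?thesis
        by (simp add: Suc)
    qed
  qed
  also have "?W = Z * A + (1 - Z) * (1 + fps_X * A)"
    unfolding right_heavy_gf A_def Z_def by (simp flip: fps_const_sub)
  finally show ?thesis
    by (simp add: algebra_simps power2_eq_square)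
qed

lemma A321_eq_tree_gf: "A321 = tree_gf fps_X"
proof (intro fps_ext)
  fix n k
  have "(tree_gf fps_X :: rat fps fps) $ n $ k = (\<Sum>t | size t = n. if tree_occ t = k then 1 else 0)"
    by (simp add: tree_gf_def fps_sum_nth fps_X_power_nth eq_commute)
  also have "\<dots> = of_nat (card {t. size t = n \<and> tree_occ t = k})"
    by (simp add: finite_trees flip: sum.inter_filter)
  finally show "A321 $ n $ k = (tree_gf fps_X :: rat fps fps) $ n $ k"
    by (simp add: A321_def a321_eq_card_trees)
qed

section \<open>Solving the quadratic equation\<close>

text \<open>In a domain two square roots differ at most by sign, and the constant term 1 rules out
  the negative one.\<close>

lemma fps_sqrt_eqI:
  fixes S :: "'a::{idom,semiring_char_0} fps"
  assumes "S ^ 2 = F" "S $ 0 = 1"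
  shows "fps_sqrt F = S"
  unfolding fps_sqrt_def
proof (rule the_equality)
  fix T assume T: "T ^ 2 = F \<and> T $ 0 = 1"
  then have "T ^ 2 = S ^ 2" using assms(1) by simp
  then have "T = S \<or> T = - S" by (simp add: power2_eq_iff)
  moreover have "T \<noteq> - S"
  proof
    assume "T = - S"
    with T assms(2) have "- 1 = (1 :: 'a)" by (metis fps_neg_nth)
    then have "(2 :: 'a) = 0" by (metis add.right_inverse one_add_one)
    then show False by simp
  qed
  ultimately show "T = S" by blast
qed (use assms in auto)

text \<open>Multiplying b A - a A^2 = 1 by -4a and adding b^2 completes the square to (b - 2 a A)^2.
  As \<open>a\<close> has no constant term, b - 2 a A has constant term 1, which selects the branch;
  but then 2a is no unit, so the quotient lives in the fraction field.\<close>

lemma to_fract_quadratic_root: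
  fixes A a b F :: "'a::{idom,semiring_char_0} fps"
  assumes "A = 1 + (1 - b) * A + a * A ^ 2" "F = b ^ 2 - 4 * a" "a \<noteq> 0" "a $ 0 = 0" "b $ 0 = 1"
  shows "to_fract A = to_fract (b - fps_sqrt F) / to_fract (2 * a)"
proof -
  have "fps_sqrt F = b - 2 * a * A"
  proof (rule fps_sqrt_eqI)
    have "b * A - a * A ^ 2 = 1" using assms(1) by (simp add: algebra_simps)
    then have "b ^ 2 - 4 * a * (b * A - a * A ^ 2) = F" by (simp add: assms(2))
    then show "(b - 2 * a * A) ^ 2 = F" by (simp add: algebra_simps power2_eq_square)
  qed (simp add: assms(4,5))
  then have "b - fps_sqrt F = 2 * a * A" by simp
  moreover have "to_fract (2 * a) \<noteq> 0" unfolding to_fract_eq_0_iff using assms(3) by simp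
  ultimately show ?thesis
    by (simp only: to_fract_mult[of "2 * a" A] nonzero_mult_div_cancel_left simp_thms not_False_eq_True)
qed

section \<open>The coefficient formula\<close>

text \<open>Lagrange inversion for \<open>y = fps_X * tree_gf z\<close>, with \<open>P\<close> the
  numerator of the kernel and \<open>G\<close> the geometric series that stands for 1/(1 - z
  x).\<close>

lemma tree_gf_nth_eq:
  fixes z :: "'a::{idom,semiring_char_0}"
  shows "of_nat (n + 1) * tree_gf z $ n =
    (\<Sum>j\<le>n. of_nat ((n + j) choose n) * z ^ j *
      (\<Sum>m\<le>n - j. of_nat ((n + 1) choose m) * (1 - z) ^ m * of_nat (m choose (n - j - m))))"
proof -
  define A where "A = tree_gf z"
  define y where "y = fps_X * A"
  define Z where "Z = fps_const z"
  define P where "P = 1 + fps_const (1 - z) * (fps_X + fps_X ^ 2)"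
  define G where "G = Abs_fps (\<lambda>n. z ^ n)"
  have y0: "y $ 0 = 0" by (simp add: y_def)
  have X: "fps_X oo y = y" using y0 by simp
  have Py: "P oo y = 1 + (1 - Z) * (y + y ^ 2)"
    by (simp add: P_def Z_def fps_compose_add_distrib fps_compose_sub_distrib
        fps_compose_mult_distrib[OF y0] X flip: fps_compose_power[OF y0] fps_const_sub)
  have Gy: "(G oo y) * (1 - Z * y) = 1"
  proof -
    have "(G * (1 - Z * fps_X)) oo y = 1"
      by (simp add: G_def Z_def geometric_fps_mult)
    then show ?thesis
      by (simp add: fps_compose_mult_distrib[OF y0] fps_compose_sub_distrib X Z_def)
  qed
  \<comment> \<open>Multiplied by t, the quadratic for \<open>A\<close> becomes y = t + t (1 - z) y
    + (t + z - t z) y^2; moving z y^2 to the left leaves a multiple of t on the right.\<close>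
  have yZ: "y * (1 - Z * y) = fps_X * (1 + (1 - Z) * (y + y ^ 2))"
  proof -
    have "fps_X * A = fps_X * (1 + fps_X * (1 - Z) * A + fps_X * (fps_X + Z - fps_X * Z) * A ^ 2)"
      using tree_gf_quadratic[of z] by (simp only: A_def Z_def)
    then show ?thesis
      by (simp add: y_def algebra_simps power2_eq_square)
  qed
  have "fps_X * (P * G oo y) = fps_X * (1 + (1 - Z) * (y + y ^ 2)) * (G oo y)"
    by (simp only: fps_compose_mult_distrib[OF y0] Py mult.assoc)
  also have "\<dots> = y * ((G oo y) * (1 - Z * y))"
    by (simp only: yZ[symmetric] mult_ac)
  finally have "y = fps_X * (P * G oo y)"
    by (simp only: Gy mult_1_right)
  from lagrange_inversion[OF this, of n]
  have "of_nat (n + 1) * A $ n = (G ^ (n + 1) * P ^ (n + 1)) $ n"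
    by (simp add: y_def power_mult_distrib mult_ac)
  also have "\<dots> = (\<Sum>j = 0..n. (G ^ (n + 1)) $ j * (P ^ (n + 1)) $ (n - j))"
    by (rule fps_mult_nth)
  also have "\<dots> = (\<Sum>j\<le>n. of_nat ((n + j) choose n) * z ^ j *
      (\<Sum>m\<le>n - j. of_nat ((n + 1) choose m) * (1 - z) ^ m * of_nat (m choose (n - j - m))))"
    unfolding G_def P_def geometric_fps_power_nth fps_quadratic_power_nth
    by (simp only: atLeast0AtMost)
  finally show ?thesis by (simp only: A_def)
qed

text \<open>Substitute m = n - i, then pull the factor free of i out of the product of the first two
  binomials by trinomial revision.\<close>

lemma trinomial_sum_reindex:
  fixes n j k :: nat
  assumes "j \<le> n" "j \<le> k"
  shows "(\<Sum>m\<le>n - j. ((n + 1) choose m) * (m choose (k - j)) * (m choose (n - j - m))) =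
    ((n + 1) choose (k - j)) *
      (\<Sum>i = j..(n + j) div 2. ((n + j + 1 - k) choose (i + 1)) * ((n - i) choose (i - j)))"
proof -
  have "(\<Sum>m\<le>n - j. ((n + 1) choose m) * (m choose (k - j)) * (m choose (n - j - m))) =
      (\<Sum>i = j..n. ((n + 1) choose (n - i)) * ((n - i) choose (k - j)) * ((n - i) choose (i - j)))"
    by (rule sum.reindex_bij_witness[of _ "\<lambda>i. n - i" "\<lambda>m. n - m"]) (use assms in \<open>auto simp: add.commute\<close>)
  \<comment> \<open>If 2 i > n + j, then i - j > n - i and the last binomial vanishes.\<close>
  also have "\<dots> = (\<Sum>i = j..(n + j) div 2.
      ((n + 1) choose (n - i)) * ((n - i) choose (k - j)) * ((n - i) choose (i - j)))"
    using assms by (intro sum.mono_neutral_right) (auto intro!: binomial_eq_0)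
  also have "\<dots> = (\<Sum>i = j..(n + j) div 2. ((n + 1) choose (k - j)) *
      (((n + j + 1 - k) choose (i + 1)) * ((n - i) choose (i - j))))"
  proof (intro sum.cong refl)
    fix i assume "i \<in> {j..(n + j) div 2}"
    then have i: "j \<le> i" "i \<le> n" using assms by auto
    have "((n + 1) choose (n - i)) * ((n - i) choose (k - j)) =
        ((n + 1) choose (k - j)) * ((n + j + 1 - k) choose (i + 1))"
    proof (cases "k - j \<le> n - i")
      case True
      have "((n + 1) choose (n - i)) * ((n - i) choose (k - j)) =
          ((n + 1) choose (k - j)) * ((n + 1 - (k - j)) choose (n - i - (k - j)))"
        using True by (intro choose_mult) auto
      also have "(n + 1 - (k - j)) choose (n - i - (k - j)) = (n + 1 - (k - j)) choose (i + 1)"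
        using True i by (subst binomial_symmetric) (auto intro!: arg_cong2[of _ _ _ _ binomial])
      also have "n + 1 - (k - j) = n + j + 1 - k" using assms by simp
      finally show ?thesis .
    next
      \<comment> \<open>Both sides vanish: \<open>n - i < k - j\<close> on the left,
        \<open>n + j + 1 - k < i + 1\<close> on the right.\<close>
      case False
      then show ?thesis using assms i by (simp add: binomial_eq_0)
    qed
    then show "((n + 1) choose (n - i)) * ((n - i) choose (k - j)) * ((n - i) choose (i - j)) =
        ((n + 1) choose (k - j)) * (((n + j + 1 - k) choose (i + 1)) * ((n - i) choose (i - j)))"
      by (simp only: mult.assoc)
  qed
  finally show ?thesis by (simp only: sum_distrib_left)
qed

text \<open>This compares coefficients of z^k in \<open>tree_gf_nth_eq\<close> at
  \<open>z = fps_X\<close>, where the index j is the exponent taken from the geometric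
  factor.\<close>

lemma a321_formula:
  "(of_nat (n + 1) :: rat) * of_nat (a321 n k) =
    (\<Sum>j = 0..k. (-1) ^ (k - j) * of_nat ((n + j) choose n) * of_nat ((n + 1) choose (k - j)) *
      (\<Sum>i = j..(n + j) div 2.
         of_nat ((n + j + 1 - k) choose (i + 1)) * of_nat ((n - i) choose (i - j))))"
proof -
  let ?I = "\<lambda>j. \<Sum>i = j..(n + j) div 2. ((n + j + 1 - k) choose (i + 1)) * ((n - i) choose (i - j))"
  let ?T = "\<lambda>j. (-1) ^ (k - j) * of_nat ((n + j) choose n) * of_nat ((n + 1) choose (k - j)) * (of_nat (?I j) :: rat)"
  have "(of_nat (n + 1) :: rat) * of_nat (a321 n k) = (of_nat (n + 1) * tree_gf fps_X $ n) $ k"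
    by (simp add: A321_def flip: A321_eq_tree_gf fps_of_nat)
  also have "\<dots> = (\<Sum>j\<le>n. \<Sum>m\<le>n - j.
      (fps_const (of_nat ((n + j) choose n) * of_nat ((n + 1) choose m) * of_nat (m choose (n - j - m))) *
       (fps_X ^ j * (1 - fps_X) ^ m)) $ k)"
    unfolding tree_gf_nth_eq fps_sum_nth sum_distrib_left
    by (intro sum.cong refl arg_cong[of _ _ "\<lambda>f. f $ k"])
      (simp add: fps_of_nat mult_ac flip: fps_const_mult)
  also have "\<dots> = (\<Sum>j\<le>n. if j \<le> k then ?T j else 0)"
  proof (intro sum.cong refl)
    fix j assume "j \<in> {..n}"
    then have j: "j \<le> n" by simp
    show "(\<Sum>m\<le>n - j.
      (fps_const (of_nat ((n + j) choose n) * of_nat ((n + 1) choose m) * of_nat (m choose (n - j - m))) *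
       (fps_X ^ j * (1 - fps_X) ^ m)) $ k) = (if j \<le> k then ?T j else 0)" (is "?L = _")
    proof (cases "j \<le> k")
      case True
      then have "?L = (-1) ^ (k - j) * of_nat ((n + j) choose n) *
          of_nat (\<Sum>m\<le>n - j. ((n + 1) choose m) * (m choose (k - j)) * (m choose (n - j - m)))"
        unfolding fps_mult_left_const_nth fps_X_power_one_minus_X_power_nth
          of_nat_sum of_nat_mult sum_distrib_left
        by (intro sum.cong refl) simp
      also have "\<dots> = ?T j"
        unfolding trinomial_sum_reindex[OF j True] by (simp only: of_nat_mult mult.assoc)
      finally show ?thesis using True by (simp only: if_True)
    qed (simp add: fps_X_power_one_minus_X_power_nth)
  qed
  also have "\<dots> = (\<Sum>j \<in> {..n} \<inter> {..k}. ?T j)"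
    by (subst sum.inter_restrict) simp_all
  \<comment> \<open>For j > n the inner sum is empty, since (n + j) div 2 < j.\<close>
  also have "\<dots> = (\<Sum>j = 0..k. ?T j)"
    by (intro sum.mono_neutral_left) auto
  finally show ?thesis by (simp only: of_nat_sum of_nat_mult)
qed

theorem theorem3:
  "to_fract A321 =
     to_fract (1 - var_t + var_t * var_z
               - fps_sqrt (1 - 2 * var_t - 3 * var_t ^ 2
                           + var_t * var_z * (var_t * var_z + 2 * var_t - 2)))
     / to_fract (2 * var_t * (var_t + var_z - var_t * var_z))
   \<and> (\<forall>n k. (of_nat (a321 n k) :: rat) =
        1 / of_nat (n + 1) *
        (\<Sum>j = 0..k. (-1) ^ (k - j) * of_nat ((n + j) choose n) * of_nat ((n + 1) choose (k - j)) *
          (\<Sum>i = j..(n + j) div 2.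
             of_nat ((n + j + 1 - k) choose (i + 1)) * of_nat ((n - i) choose (i - j)))))"
proof (intro conjI allI)
  let ?a = "var_t * (var_t + var_z - var_t * var_z)" and ?b = "1 - var_t + var_t * var_z"
  \<comment> \<open>The constant term in t of this factor is z, which is nonzero.\<close>
  have "(var_t + var_z - var_t * var_z) $ 0 \<noteq> 0" by simp
  then have ne: "?a \<noteq> 0" by (metis fps_X_neq_zero fps_zero_nth mult_eq_0_iff)
  have root: "A321 = 1 + (1 - ?b) * A321 + ?a * A321 ^ 2"
    using tree_gf_quadratic[of "fps_X :: rat fps"] by (simp add: A321_eq_tree_gf algebra_simps)
  have disc: "1 - 2 * var_t - 3 * var_t ^ 2 + var_t * var_z * (var_t * var_z + 2 * var_t - 2) =
      ?b ^ 2 - 4 * ?a"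
    by (simp add: algebra_simps power2_eq_square)
  show "to_fract A321 =
     to_fract (1 - var_t + var_t * var_z
               - fps_sqrt (1 - 2 * var_t - 3 * var_t ^ 2
                           + var_t * var_z * (var_t * var_z + 2 * var_t - 2)))
     / to_fract (2 * var_t * (var_t + var_z - var_t * var_z))"
    unfolding mult.assoc[of 2] by (rule to_fract_quadratic_root[OF root disc ne]) simp_all
next
  fix n k
  show "(of_nat (a321 n k) :: rat) =
        1 / of_nat (n + 1) *
        (\<Sum>j = 0..k. (-1) ^ (k - j) * of_nat ((n + j) choose n) * of_nat ((n + 1) choose (k - j)) *
          (\<Sum>i = j..(n + j) div 2.
             of_nat ((n + j + 1 - k) choose (i + 1)) * of_nat ((n - i) choose (i - j))))"
    unfolding a321_formula[symmetric] by simp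
qed

end
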